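(* For all integers $n,k\ge 0$, we have $|S_{n,k}|\le (C_n)^k$, where $C_n=\frac{1}{n+1}\binom{2n}{n}$.
   Context: $S_n$ is the set of permutations of $\{0,1,\ldots,n-1\}$, written as sequences of length $n$. $I_n$ is the set of inversion sequences of length $n$, i.e. integer sequences $\sigma=(\sigma_1,\ldots,\sigma_n)$ with $0\le\sigma_i<i$ for every $1\le i\le n$ (the empty sequence is allowed, with $n=0$). For a finite integer sequence $\sigma$ of length $n$, $\Theta(\sigma)$ is the sequence of length $n$ defined by $\Theta(\sigma)_i=\#\{j<i:\sigma_j<\sigma_i\}$; $\Theta^k$ is the $k$-fold iterate, with $\Theta^0$ the identity. $FP_n=\{\sigma\in I_n:\Theta(\sigma)=\sigma\}$ and $S_{n,k}=\{\sigma\in S_n:\Theta^k(\sigma)\in FP_n\}$. *)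

theory Defs
  imports Complex_Main "HOL-Combinatorics.Multiset_Permutations"
begin

text \<open>
  Finite integer sequences are lists. List positions start at 0, so the entry \<open>\<sigma>\<^sub>i\<close>
  (with \<open>1 \<le> i \<le> n\<close>) is \<open>\<sigma> ! (i - 1)\<close>.
\<close>

text \<open>In terms of the 1-based position \<open>i + 1\<close>, the bound reads \<open>0 \<le> \<sigma>\<^sub>i\<^sub>+\<^sub>1 < i + 1\<close>.\<close>

definition inversion_seqs :: "nat \<Rightarrow> int list set" where
  "inversion_seqs n = {\<sigma>. length \<sigma> = n \<and> (\<forall>i<n. 0 \<le> \<sigma> ! i \<and> \<sigma> ! i < int (i + 1))}"

definition Theta :: "int list \<Rightarrow> int list" where
  "Theta \<sigma> = map (\<lambda>i. int (card {j. j < i \<and> \<sigma> ! j < \<sigma> ! i})) [0..<length \<sigma>]"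

definition FP :: "nat \<Rightarrow> int list set" where
  "FP n = {\<sigma> \<in> inversion_seqs n. Theta \<sigma> = \<sigma>}"

definition S :: "nat \<Rightarrow> nat \<Rightarrow> int list set" where
  "S n k = {\<sigma> \<in> permutations_of_set {0..<int n}. (Theta ^^ k) \<sigma> \<in> FP n}"

definition catalan :: "nat \<Rightarrow> real" where
  "catalan n = 1 / (real n + 1) * real ((2 * n) choose n)"

end

theory Submission
  imports Defs
begin

text \<open>
  Reading a sequence from the right, its last entry \<open>v\<close> is determined by the multiset of all entries
  together with \<open>\<Theta>\<close>, because \<open>v\<close> has exactly \<open>\<Theta>(\<sigma>)\<^sub>n\<close> smaller entries. Hence each fibre of \<open>\<Theta>\<close> on
  \<open>I\<^sub>n\<close> injects into the possible multisets of entries, whose sorted versions are the weakly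
  increasing sequences below the diagonal, and there are \<open>C\<^sub>n\<close> of these. On permutations \<open>\<Theta>\<close> is
  even injective. A fixed point is determined by its multiset of entries alone: its last entry is the
  largest \<open>v\<close> that has exactly \<open>v\<close> smaller entries. Thus \<open>|FP\<^sub>n| \<le> C\<^sub>n\<close>, and pulling back \<open>FP\<^sub>n\<close>
  along \<open>\<Theta>\<close> costs one factor \<open>C\<^sub>n\<close> for each step inside \<open>I\<^sub>n\<close>.
\<close>

section \<open>Subdiagonal multisets and ballot numbers\<close>

text \<open>The last condition says that the sorted sequence of entries, indexed from 0, lies weakly below
  the diagonal, since the first occurrence of \<open>x\<close> has index \<open>size {#y \<in># M. y < x#}\<close>.\<close>

definition subdiagonal :: "nat \<Rightarrow> nat \<Rightarrow> int multiset set" where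
  "subdiagonal n m = {M. size M = n \<and>
     (\<forall>x\<in>#M. 0 \<le> x \<and> x \<le> int m \<and> x \<le> int (size {#y \<in># M. y < x#}))}"

text \<open>The reflection formula for lattice paths weakly below the diagonal. Integer values keep
  the recurrence valid above the diagonal, where the difference can be negative.\<close>

fun ballot :: "nat \<Rightarrow> nat \<Rightarrow> int" where
  "ballot n 0 = 1"
| "ballot n (Suc m) = int ((n + Suc m) choose Suc m) - int ((n + Suc m) choose m)"

lemma ballot_rec: "ballot (Suc n) (Suc m) = ballot (Suc n) m + ballot n (Suc m)"
  by (cases m) (simp_all)

lemma ballot_above_diagonal: "ballot n (Suc n) = 0"
  using binomial_symmetric[of "Suc n" "n + Suc n"] by simp

lemma ballot_eq_catalan: "real_of_int (ballot n n) = catalan n"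
proof (cases n)
  case (Suc m)
  \<comment> \<open>By absorption both sides equal
    \<open>2 * n * ((2 * n - 1) choose m)\<close>.\<close>
  have "Suc m * ((2 * n) choose Suc m) = (2 * n - m) * ((2 * n) choose m)"
    using binomial_absorb_comp[of "2 * n" m] binomial_absorption[of m "2 * n"] Suc by simp
  then have "Suc m * ((2 * n) choose n) = Suc n * ((2 * n) choose m)"
    using Suc by simp
  then have "real n * real ((2 * n) choose n) = (real n + 1) * real ((2 * n) choose m)"
    using Suc by (metis of_nat_Suc of_nat_mult add.commute)
  moreover have "real_of_int (ballot n n) = real ((2 * n) choose n) - real ((2 * n) choose m)"
    using Suc by (simp add: mult_2)
  ultimately have "(real n + 1) * real_of_int (ballot n n) = real ((2 * n) choose n)"
    by (simp only: right_diff_distrib) (simp add: distrib_right)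
  then show ?thesis
    by (simp add: catalan_def field_simps)
qed (simp add: catalan_def)

lemma subdiagonal_0: "subdiagonal n 0 \<subseteq> {replicate_mset n 0}"
proof
  fix M assume "M \<in> subdiagonal n 0"
  then have "size M = n" "set_mset M \<subseteq> {0}"
    by (auto simp: subdiagonal_def)
  then show "M \<in> {replicate_mset n 0}"
    by (metis set_mset_subset_singletonD singletonI)
qed

text \<open>Removing one copy of the largest admissible value changes no count for the other
  entries. That value needs \<open>Suc m\<close> smaller ones among the remaining \<open>n\<close>,
  hence \<open>m < n\<close>.\<close>

lemma subdiagonal_Suc:
  "subdiagonal (Suc n) (Suc m) \<subseteq> subdiagonal (Suc n) m \<union>
     (if m < n then add_mset (int (Suc m)) ` subdiagonal n (Suc m) else {})"
proof
  fix M assume M: "M \<in> subdiagonal (Suc n) (Suc m)"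
  show "M \<in> subdiagonal (Suc n) m \<union>
     (if m < n then add_mset (int (Suc m)) ` subdiagonal n (Suc m) else {})"
  proof (cases "int (Suc m) \<in># M")
    case True
    then obtain N where N: "M = add_mset (int (Suc m)) N"
      by (metis insert_DiffM)
    have "size N = n"
      using M N by (simp add: subdiagonal_def)
    moreover have "int (Suc m) \<le> int (size {#y \<in># N. y < int (Suc m)#})"
      using M N by (force simp: subdiagonal_def)
    moreover have "size {#y \<in># N. y < int (Suc m)#} \<le> size N"
      by (rule size_filter_mset_lesseq)
    moreover have "N \<in> subdiagonal n (Suc m)"
    proof -
      have "{#y \<in># M. y < x#} = {#y \<in># N. y < x#}" if "x \<in># N" for x
        using that M N by (fastforce simp: subdiagonal_def)
      then show ?thesis
        using M N by (auto simp: subdiagonal_def)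
    qed
    ultimately show ?thesis
      using N by auto
  next
    case False
    then have "x \<le> int m" if "x \<in># M" for x
      using that M by (cases "x = int (Suc m)") (force simp: subdiagonal_def)+
    then show ?thesis
      using M by (auto simp: subdiagonal_def)
  qed
qed

lemma card_subdiagonal:
  "m \<le> n \<Longrightarrow> finite (subdiagonal n m) \<and> int (card (subdiagonal n m)) \<le> ballot n m"
proof (induction "n + m" arbitrary: n m rule: less_induct)
  case less
  show ?case
  proof (cases m)
    case 0
    have "finite (subdiagonal n 0)" "card (subdiagonal n 0) \<le> 1"
      using finite_subset[OF subdiagonal_0] card_mono[OF _ subdiagonal_0] by auto
    then show ?thesis
      using 0 by simp
  next
    case (Suc m')
    then obtain n' where n: "n = Suc n'"
      using less.prems by (cases n) auto
    let ?A = "subdiagonal (Suc n') m'"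
    let ?B = "if m' < n' then add_mset (int (Suc m')) ` subdiagonal n' (Suc m') else {}"
    have A: "finite ?A" "int (card ?A) \<le> ballot (Suc n') m'"
      using less.hyps[of "Suc n'" m'] less.prems n Suc by auto
    have B: "finite ?B \<and> int (card ?B) \<le> ballot n' (Suc m')"
    proof (cases "m' < n'")
      case True
      then have fin: "finite (subdiagonal n' (Suc m'))"
        and le: "int (card (subdiagonal n' (Suc m'))) \<le> ballot n' (Suc m')"
        using less.hyps[of n' "Suc m'"] n Suc by auto
      then show ?thesis
        using True card_image_le[OF fin, of "add_mset (int (Suc m'))"] by auto
    next
      case False
      \<comment> \<open>The part containing \<open>Suc m'\<close> is empty here, and its ballot
        number vanishes as well.\<close>
      then have "m' = n'"
        using less.prems n Suc by simp
      then show ?thesis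
        using ballot_above_diagonal[of n'] by simp
    qed
    have "subdiagonal n m \<subseteq> ?A \<union> ?B"
      using subdiagonal_Suc n Suc by simp
    moreover have "finite (?A \<union> ?B)"
      using A B by blast
    ultimately have "finite (subdiagonal n m)" "card (subdiagonal n m) \<le> card ?A + card ?B"
      using finite_subset card_mono card_Un_le le_trans by metis+
    moreover have "ballot n m = ballot (Suc n') m' + ballot n' (Suc m')"
      using ballot_rec n Suc by simp
    ultimately show ?thesis
      using A B by linarith
  qed
qed

corollary finite_subdiagonal: "finite (subdiagonal n n)"
  using card_subdiagonal by simp

corollary card_subdiagonal_le_catalan: "real (card (subdiagonal n n)) \<le> catalan n"
  using card_subdiagonal[of n n] ballot_eq_catalan[of n] by linarith

section \<open>Reconstruction from the multiset of entries\<close>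

lemma length_Theta [simp]: "length (Theta xs) = length xs"
  by (simp add: Theta_def)

lemma card_less_eq_size_filter:
  "card {j. j < length xs \<and> xs ! j < x} = size {#y \<in># mset xs. y < x#}" for x :: int
  by (simp only: mset_filter[symmetric] size_mset length_filter_conv_card)

text \<open>Earlier values of \<open>Theta\<close> do not see a new last entry, which makes
  induction from the right work.\<close>

lemma Theta_snoc: "Theta (xs @ [x]) = Theta xs @ [int (size {#y \<in># mset xs. y < x#})]"
proof -
  have 1: "{j. j < i \<and> (xs @ [x]) ! j < (xs @ [x]) ! i} = {j. j < i \<and> xs ! j < xs ! i}"
    if "i < length xs" for i
    using that by (auto simp: nth_append)
  have 2: "{j. j < length xs \<and> (xs @ [x]) ! j < x} = {j. j < length xs \<and> xs ! j < x}"
    by (auto simp: nth_append)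
  show ?thesis
    by (simp add: Theta_def 1 2 card_less_eq_size_filter)
qed

lemma Theta_inversion_seq: "Theta xs \<in> inversion_seqs (length xs)"
proof -
  have "card {j. j < i \<and> xs ! j < xs ! i} < i + 1" for i
    using card_mono[of "{..<i}" "{j. j < i \<and> xs ! j < xs ! i}"] by fastforce
  then have "int (card {j. j < i \<and> xs ! j < xs ! i}) < int (i + 1)" for i
    by (simp only: of_nat_less_iff)
  then show ?thesis
    by (simp add: inversion_seqs_def Theta_def)
qed

text \<open>The element \<open>x\<close> itself is counted below \<open>y\<close> but not below
  \<open>x\<close>. So members of \<open>M\<close> are told apart by how many elements lie below
  them.\<close>

lemma size_filter_less_mono:
  fixes x y :: "'a :: linorder"
  assumes "x \<in># M" "x < y"
  shows "size {#z \<in># M. z < x#} < size {#z \<in># M. z < y#}"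
proof (rule mset_subset_size, unfold subset_mset.less_le, intro conjI)
  show "{#z \<in># M. z < x#} \<subseteq># {#z \<in># M. z < y#}"
    using assms(2) by (intro filter_mset_mono_strong) auto
  show "{#z \<in># M. z < x#} \<noteq> {#z \<in># M. z < y#}"
  proof -
    have "x \<in># {#z \<in># M. z < y#}" "x \<notin># {#z \<in># M. z < x#}"
      using assms by simp_all
    then show ?thesis
      by metis
  qed
qed

lemma eq_if_mset_Theta_eq:
  "\<lbrakk>mset xs = mset ys; Theta xs = Theta ys\<rbrakk> \<Longrightarrow> xs = ys"
proof (induction xs arbitrary: ys rule: rev_induct)
  case (snoc x xs)
  then obtain zs y where ys: "ys = zs @ [y]"
    by (metis mset_zero_iff snoc_eq_iff_butlast rev_exhaust)
  let ?M = "mset (xs @ [x])"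
  have M: "?M = add_mset x (mset xs)" "?M = add_mset y (mset zs)"
    using snoc.prems(1) ys by simp_all
  have Th: "Theta xs = Theta zs"
    "size {#z \<in># mset xs. z < x#} = size {#z \<in># mset zs. z < y#}"
    using snoc.prems(2) ys by (simp_all add: Theta_snoc)
  \<comment> \<open>No entry is below itself, so counts over the two prefixes become counts over the
    common multiset.\<close>
  have "{#z \<in># ?M. z < x#} = {#z \<in># mset xs. z < x#}"
    unfolding M(1) by simp
  moreover have "{#z \<in># ?M. z < y#} = {#z \<in># mset zs. z < y#}"
    unfolding M(2) by simp
  ultimately have eq: "size {#z \<in># ?M. z < x#} = size {#z \<in># ?M. z < y#}"
    using Th by simp
  have "x \<in># ?M" "y \<in># ?M"
    using M by (metis union_single_eq_member)+
  note less = size_filter_less_mono[OF this(1), of y] size_filter_less_mono[OF this(2), of x]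
  have "x = y"
  proof (rule linorder_cases)
    assume "x < y"
    with less(1) eq show ?thesis
      by linarith
  next
    assume "y < x"
    with less(2) eq show ?thesis
      by linarith
  qed
  moreover have "mset xs = mset zs"
    using M \<open>x = y\<close> by simp
  ultimately show ?case
    using snoc.IH Th ys by simp
qed simp

lemma mset_inversion_seq:
  assumes "xs \<in> inversion_seqs n"
  shows "mset xs \<in> subdiagonal n n"
proof -
  have le: "0 \<le> xs ! i" "xs ! i \<le> int i" if "i < n" for i
    using assms that by (auto simp: inversion_seqs_def)
  have n: "length xs = n"
    using assms by (simp add: inversion_seqs_def)
  have "0 \<le> x \<and> x \<le> int n \<and> x \<le> int (size {#y \<in># mset xs. y < x#})" if x: "x \<in># mset xs" for x
  proof -
    obtain i where i: "i < n" "xs ! i = x"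
      using x n by (auto simp: in_set_conv_nth)
    \<comment> \<open>The entry at 0-based position \<open>j\<close> is at most \<open>j\<close>,
      hence below \<open>x\<close> whenever \<open>j < x\<close>.\<close>
    have "{..<nat x} \<subseteq> {j. j < length xs \<and> xs ! j < x}"
    proof
      fix j assume "j \<in> {..<nat x}"
      then have "int j < x"
        by (simp add: zless_nat_eq_int_zless)
      moreover from this have "j < n"
        using le(2)[OF i(1)] i by linarith
      ultimately show "j \<in> {j. j < length xs \<and> xs ! j < x}"
        using le(2)[of j] n by simp
    qed
    then have "nat x \<le> card {j. j < length xs \<and> xs ! j < x}"
      using card_mono[of "{j. j < length xs \<and> xs ! j < x}" "{..<nat x}"] by simp
    then show ?thesis
      using le[OF i(1)] i unfolding card_less_eq_size_filter by linarith
  qed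
  then show ?thesis
    using n by (simp add: subdiagonal_def)
qed

lemma FP_snoc:
  assumes "xs @ [x] \<in> FP n"
  shows "xs \<in> FP (length xs)" "x = int (size {#y \<in># mset xs. y < x#})"
proof -
  have "Theta xs = xs" "x = int (size {#y \<in># mset xs. y < x#})"
    using assms by (auto simp: FP_def Theta_snoc)
  then show "xs \<in> FP (length xs)" "x = int (size {#y \<in># mset xs. y < x#})"
    using Theta_inversion_seq[of xs] by (simp_all add: FP_def)
qed

text \<open>A smaller last entry of \<open>xs\<close> would leave \<open>y\<close> among the earlier entries of \<open>xs\<close>, which contain
  only \<open>y - 1\<close> entries below \<open>y\<close>; this is too few for an inversion sequence.\<close>

lemma FP_last_le:
  assumes xs: "xs @ [x] \<in> FP n" and ys: "ys @ [y] \<in> FP n"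
    and eq: "mset (xs @ [x]) = mset (ys @ [y])"
  shows "y \<le> x"
proof (rule ccontr)
  assume "\<not> y \<le> x"
  then have "x < y"
    by simp
  have M: "add_mset x (mset xs) = add_mset y (mset ys)"
    using eq by simp
  then have "y \<in># mset xs"
    using \<open>x < y\<close> by (metis insert_noteq_member less_irrefl)
  moreover have "mset xs \<in> subdiagonal (length xs) (length xs)"
    using FP_snoc(1)[OF xs] by (intro mset_inversion_seq) (simp add: FP_def)
  ultimately have "y \<le> int (size {#z \<in># mset xs. z < y#})"
    by (simp add: subdiagonal_def)
  moreover have "{#z \<in># mset ys. z < y#} = add_mset x {#z \<in># mset xs. z < y#}"
    using arg_cong[OF M, of "filter_mset (\<lambda>z. z < y)"] \<open>x < y\<close> by simp
  ultimately show False
    using FP_snoc(2)[OF ys] by simp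
qed

lemma FP_eq_if_mset_eq:
  "\<lbrakk>xs \<in> FP n; ys \<in> FP n; mset xs = mset ys\<rbrakk> \<Longrightarrow> xs = ys"
proof (induction xs arbitrary: n ys rule: rev_induct)
  case (snoc x xs)
  then obtain zs y where ys: "ys = zs @ [y]"
    by (metis mset_zero_iff snoc_eq_iff_butlast rev_exhaust)
  have "x = y"
    using FP_last_le[of xs x n zs y] FP_last_le[of zs y n xs x] snoc.prems ys by simp
  moreover have "mset xs = mset zs"
    using snoc.prems(3) ys \<open>x = y\<close> by simp
  moreover from this have "length xs = length zs"
    by (rule mset_eq_length)
  ultimately have "xs = zs"
    using FP_snoc(1)[of xs x n] FP_snoc(1)[of zs y n] snoc.prems(1,2) ys
    by (intro snoc.IH[of "length xs"]) simp_all
  then show ?case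
    using \<open>x = y\<close> ys by simp
qed simp

section \<open>Counting\<close>

definition FP_preimage :: "nat \<Rightarrow> nat \<Rightarrow> int list set" where
  "FP_preimage n k = {\<sigma> \<in> inversion_seqs n. (Theta ^^ k) \<sigma> \<in> FP n}"

lemma Theta_FP_preimage:
  assumes "length \<sigma> = n" "(Theta ^^ Suc k) \<sigma> \<in> FP n"
  shows "Theta \<sigma> \<in> FP_preimage n k"
  using assms Theta_inversion_seq[of \<sigma>] by (simp add: FP_preimage_def funpow_swap1)

text \<open>One factor bounds the fixed points, and each of the \<open>k\<close> steps adds one for
  the fibres.\<close>

lemma card_FP_preimage:
  "finite (FP_preimage n k) \<and> card (FP_preimage n k) \<le> card (subdiagonal n n) ^ Suc k"
proof (induction k)
  case 0
  have "inj_on mset (FP_preimage n 0)"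
    using FP_eq_if_mset_eq by (auto simp: inj_on_def FP_preimage_def)
  moreover have "mset ` FP_preimage n 0 \<subseteq> subdiagonal n n"
    using mset_inversion_seq by (auto simp: FP_preimage_def)
  ultimately show ?case
    using finite_subdiagonal[of n] by (auto intro: inj_on_finite card_inj_on_le)
next
  case (Suc k)
  let ?f = "\<lambda>\<sigma>. (mset \<sigma>, Theta \<sigma>)"
  have inj: "inj_on ?f (FP_preimage n (Suc k))"
    using eq_if_mset_Theta_eq by (auto simp: inj_on_def)
  have sub: "?f ` FP_preimage n (Suc k) \<subseteq> subdiagonal n n \<times> FP_preimage n k"
    using mset_inversion_seq Theta_FP_preimage
    by (auto simp: FP_preimage_def inversion_seqs_def)
  have fin: "finite (subdiagonal n n \<times> FP_preimage n k)"
    using Suc finite_subdiagonal by simp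
  have "card (FP_preimage n (Suc k)) \<le> card (subdiagonal n n \<times> FP_preimage n k)"
    using card_inj_on_le[OF inj sub fin] .
  also have "\<dots> \<le> card (subdiagonal n n) ^ Suc (Suc k)"
    using Suc by (simp add: card_cartesian_product)
  finally show ?case
    using inj_on_finite[OF inj sub fin] by simp
qed

lemma S_mset: "\<sigma> \<in> S n k \<Longrightarrow> mset \<sigma> = mset_set {0..<int n}"
  by (metis (no_types, lifting) S_def mem_Collect_eq mset_set_set permutations_of_setD)

lemma S_length: "\<sigma> \<in> S n k \<Longrightarrow> length \<sigma> = n"
  by (metis S_mset size_mset size_mset_set card_atLeastLessThan_int diff_zero nat_int)

text \<open>All permutations share one multiset of entries. So the first \<open>Theta\<close> is
  injective and costs no factor, and for \<open>k = 0\<close> at most one permutation is a fixed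
  point.\<close>

lemma card_S: "card (S n k) \<le> card (subdiagonal n n) ^ k"
proof (cases k)
  case 0
  have "\<sigma> = \<tau>" if "\<sigma> \<in> S n 0" "\<tau> \<in> S n 0" for \<sigma> \<tau>
    using that S_mset[OF that(1)] S_mset[OF that(2)] FP_eq_if_mset_eq[of \<sigma> n \<tau>]
    by (simp add: S_def)
  then have "card (S n 0) \<le> Suc 0"
    by (subst card_le_Suc0_iff_eq) (auto simp: S_def)
  then show ?thesis
    using 0 by simp
next
  case (Suc l)
  have inj: "inj_on Theta (S n k)"
    by (rule inj_onI) (metis S_mset eq_if_mset_Theta_eq)
  have sub: "Theta ` S n k \<subseteq> FP_preimage n l"
  proof (rule image_subsetI)
    fix \<sigma> assume \<sigma>: "\<sigma> \<in> S n k"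
    then have "(Theta ^^ Suc l) \<sigma> \<in> FP n"
      unfolding S_def Suc by blast
    with S_length[OF \<sigma>] show "Theta \<sigma> \<in> FP_preimage n l"
      by (rule Theta_FP_preimage)
  qed
  have "card (S n k) \<le> card (FP_preimage n l)"
    using card_FP_preimage by (intro card_inj_on_le[OF inj sub]) blast
  then show ?thesis
    using card_FP_preimage[of n l] Suc by simp
qed

theorem theorem6p4:
  fixes n k :: nat
  shows "real (card (S n k)) \<le> catalan n ^ k"
proof -
  have "real (card (S n k)) \<le> real (card (subdiagonal n n)) ^ k"
    using card_S[of n k] by (metis of_nat_le_iff of_nat_power)
  also have "\<dots> \<le> catalan n ^ k"
    by (intro power_mono card_subdiagonal_le_catalan) simp
  finally show ?thesis .
qed

end
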